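(* Let $m\ge 1$ and let $\{A^{[t]}=(a_{ij}^{[t]})_{i,j=1}^m,\ t\geq 0\}$ be a family of real $m\times m$ matrices, each of which is invertible, and let $(A^{[t]})^{-1}=(b_{ij}^{[t]})$ denote the inverse of $A^{[t]}$. Assume that $\beta_{ijk}^{(s)}$, $i,j,k=1,\dots,m$, are arbitrary real functions of $s\ge 0$ such that \[\sum_{j=1}^m\beta_{ijk}^{(s)}=a_{ik}^{[s]}\qquad\text{for all } i,k \text{ and all } s\ge 0.\] Then the cubic matrices \[\mathcal M^{[s,t]}=\left(\sum_{k=1}^m\beta_{ijk}^{(s)}b_{kr}^{[t]}\right)_{i,j,r=1}^m,\qquad 0\le s\le t,\] generate a flow of algebras of type (D).
   Context: A (real) cubic matrix of size $m$ is an array $A=(a_{ijk})_{i,j,k=1}^m$ with real entries. Multiplication of type (D): for cubic matrices $A=(a_{ijk})$, $B=(b_{ijk})$, the product $C=AB=(c_{ijr})$ has entries $c_{ijr}=\sum_{k,n=1}^m a_{ijk}b_{knr}$. A family $\{\mathcal A^{[s,t]}: s,t\in\mathbb R,\ 0\le s\le t\}$ of $m$-dimensional real algebras with basis $e_1,\dots,e_m$ and multiplication $e_ie_j=\sum_{k=1}^m c_{ijk}^{[s,t]}e_k$ is called a flow of algebras (FA) of type (D) if the cubic matrices of structural constants $\mathcal M^{[s,t]}=(c_{ijk}^{[s,t]})_{i,j,k=1}^m$ satisfy the Kolmogorov-Chapman equation $\mathcal M^{[s,t]}=\mathcal M^{[s,\tau]}\mathcal M^{[\tau,t]}$ for all $0\le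 s<\tau<t$, the product being the multiplication of type (D). A family of cubic matrices generates an FA of type (D) if the algebras having these matrices as structural constants form an FA of type (D). *)

theory Defs
  imports "HOL-Analysis.Analysis"
begin

text \<open>The entry \<open>a\<^sub>i\<^sub>j\<^sub>k\<close> of a cubic matrix \<open>A\<close> is \<open>A $ i $ j $ k\<close>. Its size \<open>m\<close> is \<open>CARD('m)\<close>.\<close>

type_synonym 'm cubic_matrix = "real ^ 'm ^ 'm ^ 'm"

definition cubic_mult_D ::
  "'m::finite cubic_matrix \<Rightarrow> 'm cubic_matrix \<Rightarrow> 'm cubic_matrix" where
  "cubic_mult_D A B =
     (\<chi> i j r. \<Sum>k\<in>UNIV. \<Sum>n\<in>UNIV. A $ i $ j $ k * B $ k $ n $ r)"

text \<open>An \<open>m\<close>-dimensional real algebra with a chosen basis is modelled by a bilinear (not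
  necessarily associative, commutative or unital) multiplication on \<open>real ^ 'm\<close>, the basis
  vector \<open>e\<^sub>i\<close> being \<open>axis i 1\<close>. The structural constants of a multiplication are then the
  coordinates of the products of basis vectors.\<close>

type_synonym 'm algebra_mult = "real ^ 'm \<Rightarrow> real ^ 'm \<Rightarrow> real ^ 'm"

definition structure_constants :: "'m::finite algebra_mult \<Rightarrow> 'm cubic_matrix" where
  "structure_constants mul = (\<chi> i j k. mul (axis i 1) (axis j 1) $ k)"

definition algebra_of :: "'m::finite cubic_matrix \<Rightarrow> 'm algebra_mult" where
  "algebra_of C x y =
     (\<Sum>i\<in>UNIV. \<Sum>j\<in>UNIV. (x $ i * y $ j) *\<^sub>R (\<Sum>k\<in>UNIV. C $ i $ j $ k *\<^sub>R axis k 1))"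

text \<open>Values of a family at pairs outside \<open>0 \<le> s \<le> t\<close> are irrelevant.\<close>

definition flow_of_algebras_D :: "(real \<Rightarrow> real \<Rightarrow> 'm::finite algebra_mult) \<Rightarrow> bool" where
  "flow_of_algebras_D mul \<longleftrightarrow>
     (\<forall>s t. 0 \<le> s \<and> s \<le> t \<longrightarrow> bilinear (mul s t)) \<and>
     (\<forall>s \<tau> t. 0 \<le> s \<and> s < \<tau> \<and> \<tau> < t \<longrightarrow>
        structure_constants (mul s t) =
          cubic_mult_D (structure_constants (mul s \<tau>)) (structure_constants (mul \<tau> t)))"

definition generates_flow_D :: "(real \<Rightarrow> real \<Rightarrow> 'm::finite cubic_matrix) \<Rightarrow> bool" where
  "generates_flow_D M \<longleftrightarrow> flow_of_algebras_D (\<lambda>s t. algebra_of (M s t))"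

text \<open>\<open>algebra_of C\<close> is the unique algebra with structural constants \<open>C\<close>.\<close>

lemma structure_constants_eq_iff:
  "structure_constants mul = C \<longleftrightarrow>
     (\<forall>i j. mul (axis i 1) (axis j 1) = (\<Sum>k\<in>UNIV. C $ i $ j $ k *\<^sub>R axis k 1))"
proof -
  have "(\<Sum>k\<in>UNIV. v $ k *\<^sub>R axis k 1) = v" for v :: "real ^ 'a"
    using basis_expansion[of v] by (simp add: scalar_mult_eq_scaleR)
  then show ?thesis
    by (auto simp: structure_constants_def vec_eq_iff)
qed

lemma algebra_of_unique:
  assumes "bilinear mul"
  shows "mul = algebra_of (structure_constants mul)"
proof (intro ext)
  fix x y :: "real ^ 'a"
  have expand: "(\<Sum>k\<in>UNIV. v $ k *\<^sub>R axis k 1) = v" for v :: "real ^ 'a"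
    using basis_expansion[of v] by (simp add: scalar_mult_eq_scaleR)
  have "mul x y = mul (\<Sum>i\<in>UNIV. x $ i *\<^sub>R axis i 1) (\<Sum>j\<in>UNIV. y $ j *\<^sub>R axis j 1)"
    by (simp only: expand)
  also have "\<dots> = (\<Sum>i\<in>UNIV. \<Sum>j\<in>UNIV. (x $ i * y $ j) *\<^sub>R mul (axis i 1) (axis j 1))"
    by (simp add: bilinear_sum[OF assms] sum.cartesian_product bilinear_lmul[OF assms]
        bilinear_rmul[OF assms] mult.commute)
  also have "\<dots> = algebra_of (structure_constants mul) x y"
    by (simp add: algebra_of_def structure_constants_eq_iff[THEN iffD1, OF refl, rule_format])
  finally show "mul x y = algebra_of (structure_constants mul) x y" .
qed

lemma bilinear_algebra_of: "bilinear (algebra_of C)"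
  unfolding bilinear_def algebra_of_def
  by (auto intro!: linearI simp: algebra_simps sum.distrib scaleR_sum_right)

lemma structure_constants_algebra_of: "structure_constants (algebra_of C) = C"
proof -
  have "algebra_of C (axis i 1) (axis j 1) = (\<Sum>k\<in>UNIV. C $ i $ j $ k *\<^sub>R axis k 1)" for i j
  proof -
    have "algebra_of C (axis i 1) (axis j 1) =
        (\<Sum>i'\<in>UNIV. \<Sum>j'\<in>UNIV. if i' = i then if j' = j then
           (\<Sum>k\<in>UNIV. C $ i' $ j' $ k *\<^sub>R axis k 1) else 0 else 0)"
      unfolding algebra_of_def by (intro sum.cong refl) (auto simp: axis_def)
    also have "\<dots> = (\<Sum>i'\<in>UNIV. if i' = i then
           (\<Sum>j'\<in>UNIV. if j' = j then (\<Sum>k\<in>UNIV. C $ i' $ j' $ k *\<^sub>R axis k 1) else 0) else 0)"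
      by (intro sum.cong refl) auto
    also have "\<dots> = (\<Sum>k\<in>UNIV. C $ i $ j $ k *\<^sub>R axis k 1)"
      by simp
    finally show ?thesis .
  qed
  then show ?thesis by (simp add: structure_constants_eq_iff)
qed

end

theory Submission imports Defs begin

text \<open>
  Summing a cubic matrix over its middle index gives a square matrix, and a product of type (D)
  sees its right factor only through that square matrix: reading a cubic matrix as the list of
  its square slices \<open>C $ i\<close>, every slice of the left factor is multiplied on the right by the
  middle sum of the right factor (\<open>cubic_mult_D_slice\<close>).

  Write \<open>\<beta>\<^sub>i(s)\<close> for the square matrix with entries \<open>\<beta> i j k s\<close>, rows indexed by \<open>j\<close> and columns
  by \<open>k\<close>, and \<open>B(t)\<close> for the inverse of \<open>A(t)\<close>.  Slice \<open>i\<close> of \<open>M(s,t)\<close> is \<open>\<beta>\<^sub>i(s) B(t)\<close>, and the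
  hypothesis on \<open>\<beta>\<close> makes the middle sum of \<open>M(s,t)\<close> equal to \<open>A(s) B(t)\<close>
  (\<open>middle_sum_slicewise_mult\<close>).  The Kolmogorov-Chapman equation is then a cancellation in
  every slice: \<open>\<beta>\<^sub>i(s) B(\<tau>) A(\<tau>) B(t) = \<beta>\<^sub>i(s) B(t)\<close>.
\<close>

definition middle_sum :: "'m::finite cubic_matrix \<Rightarrow> real ^ 'm ^ 'm" where
  "middle_sum C = (\<chi> i k. \<Sum>j\<in>UNIV. C $ i $ j $ k)"

text \<open>In \<open>\<Sum>k n. a\<^sub>i\<^sub>j\<^sub>k b\<^sub>k\<^sub>n\<^sub>r\<close> the index \<open>n\<close> occurs only in the second factor, so that the sum over it
  can be carried out first; what remains is an ordinary matrix product.\<close>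

lemma cubic_mult_D_slice: "cubic_mult_D A B $ i = A $ i ** middle_sum B"
  by (simp add: cubic_mult_D_def middle_sum_def matrix_matrix_mult_def vec_eq_iff sum_distrib_left)

lemma middle_sum_slicewise_mult: "middle_sum (\<chi> i. C $ i ** P) = middle_sum C ** P"
proof -
  have "(\<Sum>j\<in>UNIV. \<Sum>k\<in>UNIV. C $ i $ j $ k * P $ k $ r)
      = (\<Sum>k\<in>UNIV. (\<Sum>j\<in>UNIV. C $ i $ j $ k) * P $ k $ r)" for i r
    by (subst sum.swap) (simp add: sum_distrib_right)
  then show ?thesis
    by (simp add: middle_sum_def matrix_matrix_mult_def vec_eq_iff)
qed

lemma matrix_inv_mult_left: "invertible P \<Longrightarrow> matrix_inv P ** P = mat 1"
  unfolding invertible_def matrix_inv_def by (metis (mono_tags, lifting) someI_ex)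

text \<open>Passing to algebras loses nothing: structural constants recover the cubic matrix, and
  bilinearity is automatic.  Only the Kolmogorov-Chapman equation for the matrices is left.\<close>

lemma generates_flow_D_iff:
  "generates_flow_D M \<longleftrightarrow>
     (\<forall>s \<tau> t. 0 \<le> s \<and> s < \<tau> \<and> \<tau> < t \<longrightarrow> M s t = cubic_mult_D (M s \<tau>) (M \<tau> t))"
  by (simp add: generates_flow_D_def flow_of_algebras_D_def bilinear_algebra_of
      structure_constants_algebra_of)

theorem theorem1:
  fixes A :: "real \<Rightarrow> real ^ 'm::finite ^ 'm"
    and \<beta> :: "'m \<Rightarrow> 'm \<Rightarrow> 'm \<Rightarrow> real \<Rightarrow> real"
  assumes "\<And>t. t \<ge> 0 \<Longrightarrow> invertible (A t)"
    and "\<And>i k s. s \<ge> 0 \<Longrightarrow> (\<Sum>j\<in>UNIV. \<beta> i j k s) = A s $ i $ k"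
  shows "generates_flow_D
           (\<lambda>s t. \<chi> i j r. \<Sum>k\<in>UNIV. \<beta> i j k s * matrix_inv (A t) $ k $ r)"
proof -
  define C :: "real \<Rightarrow> 'm cubic_matrix" where "C s = (\<chi> i j k. \<beta> i j k s)" for s
  define M :: "real \<Rightarrow> real \<Rightarrow> 'm cubic_matrix"
    where "M s t = (\<chi> i. C s $ i ** matrix_inv (A t))" for s t
  have C: "middle_sum (C s) = A s" if "s \<ge> 0" for s
    using assms(2)[OF that] by (simp add: middle_sum_def C_def vec_eq_iff)
  have "M s t = cubic_mult_D (M s \<tau>) (M \<tau> t)" if "0 \<le> s" "s < \<tau>" "\<tau> < t" for s \<tau> t
  proof -
    have \<tau>: "\<tau> \<ge> 0" using that by simp
    have "cubic_mult_D (M s \<tau>) (M \<tau> t) $ i = M s t $ i" for i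
    proof -
      have "cubic_mult_D (M s \<tau>) (M \<tau> t) $ i
          = (C s $ i ** matrix_inv (A \<tau>)) ** (A \<tau> ** matrix_inv (A t))"
        by (simp add: cubic_mult_D_slice M_def middle_sum_slicewise_mult C[OF \<tau>])
      also have "\<dots> = C s $ i ** (matrix_inv (A \<tau>) ** A \<tau>) ** matrix_inv (A t)"
        by (simp add: matrix_mul_assoc)
      also have "\<dots> = M s t $ i"
        by (simp add: matrix_inv_mult_left assms(1)[OF \<tau>] M_def)
      finally show ?thesis .
    qed
    then show ?thesis by (simp add: vec_eq_iff)
  qed
  then have "generates_flow_D M"
    by (simp add: generates_flow_D_iff)
  moreover have "M = (\<lambda>s t. \<chi> i j r. \<Sum>k\<in>UNIV. \<beta> i j k s * matrix_inv (A t) $ k $ r)"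
    by (simp add: fun_eq_iff M_def C_def matrix_matrix_mult_def vec_eq_iff)
  ultimately show ?thesis by simp
qed

end
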